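(* There exist three density matrices $\rho_1,\rho_2,\rho_3$ on $\mathbb C^4$ whose complete discrete error profile $(F(\{1,2\}),F(\{1,3\}),F(\{2,3\}),F(\{1,2,3\}))$ belongs to the classical region $\mathfrak C_3$, but for which $B_w>0$ for some $w=(w_1,w_2,w_3)$ with all $w_i>0$.
   Context: For $w\in\mathbb R^3$ with nonnegative entries define $\mathsf S_\rho(w)=\max\sum_{i=1}^3w_i\operatorname{Tr}(\rho_iM_i)$, the maximum over POVMs $(M_i)_{i=1}^3$ ($M_i\ge0$, $\sum_iM_i=\mathbb I$), and $E_\rho(w)=\sum_iw_i-\mathsf S_\rho(w)$. For $H\subseteq\{1,2,3\}$ let $w_H$ agree with $w$ on $H$ and vanish elsewhere (no renormalization); write $w_{12}=w_{\{1,2\}}$ etc. Define $B_w=E_\rho(w)-E_\rho(w_{12})-E_\rho(w_{13})-E_\rho(w_{23})$. The discrete error profile of the triple is $F(H)=E_\rho(\mathbf 1_H)$ for nonempty $H\subseteq\{1,2,3\}$, i.e. $F(H)=|H|-\max\sum_{i\in H}\operatorname{Tr}(\rho_iM_i)$ over POVMs $(M_i)_{i\in H}$. The classical region $\mathfrak C_3\subset\mathbb R^4$ is the set of all vectors $(F(\{1,2\}),F(\{1,3\}),F(\{2,3\}),F(\{1,2,3\}))$ where $F(H)=|H|-\sum_{x\in X}\max_{i\in H}p_i(x)$ for some three probability distributions $p_1,p_2,p_3$ on a finite set $X$. *)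

theory Defs
  imports "HOL-Analysis.Analysis"
begin

definition conj_transpose :: "complex^'n^'m \<Rightarrow> complex^'m^'n" where
  "conj_transpose A = (\<chi> i j. cnj (A $ j $ i))"

definition hermitian :: "complex^'n^'n \<Rightarrow> bool" where
  "hermitian A \<longleftrightarrow> conj_transpose A = A"

(* For hermitian A the form v* A v is real, so taking Re loses nothing. *)
definition psd :: "complex^'n^'n \<Rightarrow> bool" where
  "psd A \<longleftrightarrow> hermitian A \<and> (\<forall>v. 0 \<le> Re (\<Sum>i\<in>UNIV. cnj (v $ i) * (A *v v) $ i))"

definition density_matrix :: "complex^'n^'n \<Rightarrow> bool" where
  "density_matrix A \<longleftrightarrow> psd A \<and> trace A = 1"

(* Outcomes and states are indexed by the three-element type 3, in which 3 = 0;
   its elements are exactly the pairwise distinct 1, 2, 3. *)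
definition povm :: "(3 \<Rightarrow> complex^'n^'n) \<Rightarrow> bool" where
  "povm M \<longleftrightarrow> (\<forall>i. psd (M i)) \<and> (\<Sum>i\<in>UNIV. M i) = mat 1"

(* The POVMs form a nonempty compact set and the score is continuous in M, so this supremum
   is a maximum.  Tr (rho_i M_i) is real since both factors are hermitian. *)
definition success :: "(3 \<Rightarrow> complex^'n^'n) \<Rightarrow> real^3 \<Rightarrow> real" where
  "success \<rho> w = (SUP M\<in>{M. povm M}. \<Sum>i\<in>UNIV. w $ i * Re (trace (\<rho> i ** M i)))"

definition err :: "(3 \<Rightarrow> complex^'n^'n) \<Rightarrow> real^3 \<Rightarrow> real" where
  "err \<rho> w = (\<Sum>i\<in>UNIV. w $ i) - success \<rho> w"

definition restrict_weights :: "real^3 \<Rightarrow> 3 set \<Rightarrow> real^3" where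
  "restrict_weights w H = (\<chi> i. if i \<in> H then w $ i else 0)"

definition triple_defect :: "(3 \<Rightarrow> complex^'n^'n) \<Rightarrow> real^3 \<Rightarrow> real" where
  "triple_defect \<rho> w = err \<rho> w - err \<rho> (restrict_weights w {1, 2})
     - err \<rho> (restrict_weights w {1, 3}) - err \<rho> (restrict_weights w {2, 3})"

definition quantum_profile :: "(3 \<Rightarrow> complex^'n^'n) \<Rightarrow> 3 set \<Rightarrow> real" where
  "quantum_profile \<rho> H = err \<rho> (\<chi> i. indicator H i)"

definition classical_profile :: "'x set \<Rightarrow> (3 \<Rightarrow> 'x \<Rightarrow> real) \<Rightarrow> 3 set \<Rightarrow> real" where
  "classical_profile X p H = real (card H) - (\<Sum>x\<in>X. Max ((\<lambda>i. p i x) ` H))"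

definition prob_distribution_on :: "'x set \<Rightarrow> ('x \<Rightarrow> real) \<Rightarrow> bool" where
  "prob_distribution_on X q \<longleftrightarrow> (\<forall>x\<in>X. 0 \<le> q x) \<and> (\<Sum>x\<in>X. q x) = 1"

definition profile_vector :: "(3 set \<Rightarrow> real) \<Rightarrow> real^4" where
  "profile_vector F = vector [F {1, 2}, F {1, 3}, F {2, 3}, F {1, 2, 3}]"

(* Every finite sample space can be relabelled by natural numbers, so it is enough to let X
   range over the finite subsets of nat. *)
definition classical_region :: "(real^4) set" where
  "classical_region = {profile_vector (classical_profile X p) | (X :: nat set) p.
     finite X \<and> (\<forall>i. prob_distribution_on X (p i))}"

end

theory Submission
  imports Defs
begin

text \<open>Take a direct sum of a qubit block of weight 5/8, carrying the pure states along
  (1,0), (3/5,4/5) and (3/5,-4/5), and a block of weight 3/8 on which the three states coincide.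
  At equal weights the positive defect of the qubit block is outweighed by the defect of the
  common block, and the resulting profile (1/2, 1/2, 2/5, 11/8) is classical.  Raising the first
  weight to 3/2 increases the qubit defect, while the common block only sees the smallest
  weight, so the total becomes positive.  Success values are bounded below by explicit POVMs and
  above by semidefinite duality: if K dominates every weighted state, the value is at most Tr K.\<close>

section \<open>Duality\<close>

text \<open>Weak duality: replacing every weighted state by \<open>K\<close> can only raise each
  term, and the outcomes then add up to the identity. Domination by \<open>K\<close> is phrased as a
  trace inequality against positive matrices, the form in which it enters the sum.\<close>

lemma score_le_trace:
  fixes \<rho> M :: "3 \<Rightarrow> complex^'n^'n"
  assumes dual: "\<And>i N. psd N \<Longrightarrow> w $ i * Re (trace (\<rho> i ** N)) \<le> Re (trace (K ** N))"
    and M: "povm M"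
  shows "(\<Sum>i\<in>UNIV. w $ i * Re (trace (\<rho> i ** M i))) \<le> Re (trace K)"
proof -
  have psd: "psd (M i)" for i
    using M by (simp add: povm_def)
  have total: "M 1 + M 2 + M 3 = mat 1"
    using M by (simp add: povm_def sum_3)
  have "(\<Sum>i\<in>UNIV. w $ i * Re (trace (\<rho> i ** M i))) \<le> (\<Sum>i\<in>UNIV. Re (trace (K ** M i)))"
    by (intro sum_mono dual psd)
  also have "\<dots> = Re (trace (K ** (M 1 + M 2 + M 3)))"
    by (simp only: sum_3 trace_add matrix_add_ldistrib plus_complex.sel)
  also have "\<dots> = Re (trace K)"
    by (simp only: total matrix_mul_rid)
  finally show ?thesis .
qed

lemma success_le_trace:
  fixes \<rho> M :: "3 \<Rightarrow> complex^'n^'n"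
  assumes "\<And>i N. psd N \<Longrightarrow> w $ i * Re (trace (\<rho> i ** N)) \<le> Re (trace (K ** N))"
    and "povm M"
  shows "success \<rho> w \<le> Re (trace K)"
  unfolding success_def
proof (rule cSUP_least)
  show "{M :: 3 \<Rightarrow> complex^'n^'n. povm M} \<noteq> {}"
    using assms(2) by blast
next
  fix M :: "3 \<Rightarrow> complex^'n^'n"
  assume "M \<in> {M. povm M}"
  then show "(\<Sum>i\<in>UNIV. w $ i * Re (trace (\<rho> i ** M i))) \<le> Re (trace K)"
    by (intro score_le_trace[OF assms(1)]) simp_all
qed

text \<open>A real supremum bounds its members only over a bounded set; \<open>K\<close> supplies
  that bound and may be far from optimal.\<close>

lemma score_le_success:
  fixes \<rho> M :: "3 \<Rightarrow> complex^'n^'n"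
  assumes "\<And>i N. psd N \<Longrightarrow> w $ i * Re (trace (\<rho> i ** N)) \<le> Re (trace (K ** N))"
    and "povm M"
  shows "(\<Sum>i\<in>UNIV. w $ i * Re (trace (\<rho> i ** M i))) \<le> success \<rho> w"
  unfolding success_def
proof (rule cSUP_upper)
  show "M \<in> {M. povm M}"
    using assms(2) by simp
  show "bdd_above ((\<lambda>M. \<Sum>i\<in>UNIV. w $ i * Re (trace (\<rho> i ** M i))) ` {M. povm M})"
  proof (rule bdd_aboveI2)
    fix M :: "3 \<Rightarrow> complex^'n^'n"
    assume "M \<in> {M. povm M}"
    then show "(\<Sum>i\<in>UNIV. w $ i * Re (trace (\<rho> i ** M i))) \<le> Re (trace K)"
      by (intro score_le_trace[OF assms(1)]) simp_all
  qed
qed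

section \<open>Block matrices\<close>

lemma vector_4 [simp]:
  "(vector [w, x, y, z] :: ('a::zero)^4) $ 1 = w"
  "(vector [w, x, y, z] :: ('a::zero)^4) $ 2 = x"
  "(vector [w, x, y, z] :: ('a::zero)^4) $ 3 = y"
  "(vector [w, x, y, z] :: ('a::zero)^4) $ 4 = z"
  unfolding vector_def by simp_all

definition blk :: "real \<Rightarrow> real \<Rightarrow> real \<Rightarrow> real \<Rightarrow> complex^4^4" where
  "blk a b c d = vector [vector [of_real a, of_real b, 0, 0], vector [of_real b, of_real c, 0, 0],
     vector [0, 0, of_real d, 0], vector [0, 0, 0, of_real d]]"

lemma quadratic_form_nonneg:
  fixes a b c :: real
  assumes "0 \<le> a" "0 \<le> c" "b\<^sup>2 \<le> a * c"
  shows "0 \<le> a * x\<^sup>2 + 2 * b * x * y + c * y\<^sup>2"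
proof (cases "a = 0")
  case True
  then show ?thesis using assms by simp
next
  case False
  have "a * (a * x\<^sup>2 + 2 * b * x * y + c * y\<^sup>2) = (a * x + b * y)\<^sup>2 + (a * c - b\<^sup>2) * y\<^sup>2"
    by (simp add: power2_eq_square algebra_simps)
  also have "\<dots> \<ge> 0"
    using assms by simp
  finally show ?thesis
    using False assms(1) by (simp add: zero_le_mult_iff)
qed

lemma psd_blk:
  assumes "0 \<le> a" "0 \<le> c" "b\<^sup>2 \<le> a * c" "0 \<le> d"
  shows "psd (blk a b c d)"
  unfolding psd_def
proof (intro conjI allI)
  show "hermitian (blk a b c d)"
    by (simp add: hermitian_def conj_transpose_def blk_def vec_eq_iff forall_4)
next
  fix v :: "complex^4"
  note q = quadratic_form_nonneg[OF assms(1-3)]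
  have "Re (\<Sum>i\<in>UNIV. cnj (v $ i) * (blk a b c d *v v) $ i) =
      (a * (Re (v$1))\<^sup>2 + 2 * b * Re (v$1) * Re (v$2) + c * (Re (v$2))\<^sup>2)
    + (a * (Im (v$1))\<^sup>2 + 2 * b * Im (v$1) * Im (v$2) + c * (Im (v$2))\<^sup>2)
    + d * ((Re (v$3))\<^sup>2 + (Im (v$3))\<^sup>2 + (Re (v$4))\<^sup>2 + (Im (v$4))\<^sup>2)"
    by (simp add: sum_4 matrix_vector_mult_def blk_def power2_eq_square algebra_simps)
  also have "\<dots> \<ge> 0"
    using assms(4)
    by (intro add_nonneg_nonneg[OF add_nonneg_nonneg[OF q q]] mult_nonneg_nonneg) simp_all
  finally show "0 \<le> Re (\<Sum>i\<in>UNIV. cnj (v $ i) * (blk a b c d *v v) $ i)" .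
qed

lemma trace_blk [simp]: "trace (blk a b c d) = of_real (a + c + 2 * d)"
  by (simp add: trace_def sum_4 blk_def)

lemma trace_blk_mult:
  "Re (trace (blk a b c d ** N)) = a * Re (N$1$1) + b * (Re (N$1$2) + Re (N$2$1)) + c * Re (N$2$2)
     + d * (Re (N$3$3) + Re (N$4$4))"
  by (simp add: trace_def sum_4 matrix_matrix_mult_def blk_def algebra_simps)

lemma blk_add: "blk a b c d + blk a' b' c' d' = blk (a + a') (b + b') (c + c') (d + d')"
  by (simp add: blk_def vec_eq_iff forall_4)

lemma blk_one: "blk 1 0 1 1 = mat 1"
  by (simp add: blk_def vec_eq_iff forall_4 mat_def)

text \<open>The difference of the two blocks is positive, and so is its pairing with
  \<open>N\<close>. For the qubit part, \<open>A\<close> times the pairing is the form of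
  \<open>N\<close> at the vector (A, B) plus (AC - B^2) times the second diagonal entry of
  \<open>N\<close>.\<close>

lemma trace_blk_mult_mono:
  assumes N: "psd N"
    and abc: "x * a \<le> a'" "x * c \<le> c'" "(b' - x * b)\<^sup>2 \<le> (a' - x * a) * (c' - x * c)" "x * d \<le> d'"
  shows "x * Re (trace (blk a b c d ** N)) \<le> Re (trace (blk a' b' c' d' ** N))"
proof -
  have form: "0 \<le> Re (\<Sum>i\<in>UNIV. cnj (v $ i) * (N *v v) $ i)" for v
    using N by (simp add: psd_def)
  define A B C D where "A = a' - x * a" and "B = b' - x * b" and "C = c' - x * c" and "D = d' - x * d"
  have ABCD: "0 \<le> A" "0 \<le> C" "B\<^sup>2 \<le> A * C" "0 \<le> D"
    using abc by (auto simp: A_def B_def C_def D_def)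
  have pos: "0 \<le> Re (N$2$2)" "0 \<le> Re (N$1$1)" "0 \<le> Re (N$3$3)" "0 \<le> Re (N$4$4)"
    using form[of "vector [0, 1, 0, 0]"] form[of "vector [1, 0, 0, 0]"]
      form[of "vector [0, 0, 1, 0]"] form[of "vector [0, 0, 0, 1]"]
    by (simp_all add: sum_4 matrix_vector_mult_def)
  have "0 \<le> A * Re (N$1$1) + B * (Re (N$1$2) + Re (N$2$1)) + C * Re (N$2$2)"
  proof (cases "A = 0")
    \<comment> \<open>Here B^2 \<le> AC forces \<open>B = 0\<close>.\<close>
    case True
    then show ?thesis using ABCD pos by simp
  next
    case False
    have "0 \<le> A * A * Re (N$1$1) + A * B * (Re (N$1$2) + Re (N$2$1)) + B * B * Re (N$2$2)"
      using form[of "vector [of_real A, of_real B, 0, 0]"]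
      by (simp add: sum_4 matrix_vector_mult_def algebra_simps)
    also have "\<dots> \<le> A * A * Re (N$1$1) + A * B * (Re (N$1$2) + Re (N$2$1)) + A * C * Re (N$2$2)"
      using ABCD(3) pos(1) by (simp add: power2_eq_square mult_right_mono)
    also have "\<dots> = A * (A * Re (N$1$1) + B * (Re (N$1$2) + Re (N$2$1)) + C * Re (N$2$2))"
      by (simp add: algebra_simps)
    finally show ?thesis
      using False ABCD(1) by (simp add: zero_le_mult_iff)
  qed
  moreover have "0 \<le> D * (Re (N$3$3) + Re (N$4$4))"
    using ABCD(4) pos by simp
  ultimately show ?thesis
    by (simp add: trace_blk_mult A_def B_def C_def D_def algebra_simps)
qed

section \<open>The states\<close>

definition triple :: "'a \<Rightarrow> 'a \<Rightarrow> 'a \<Rightarrow> 3 \<Rightarrow> 'a" where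
  "triple x y z i = (if i = 1 then x else if i = 2 then y else z)"

lemma triple_simps [simp]: "triple x y z 1 = x" "triple x y z 2 = y" "triple x y z 3 = z"
  by (simp_all add: triple_def)

text \<open>The projector onto (3/5, \<plusminus>4/5), scaled by 5/8, has entries 9/40,
  \<plusminus>3/10, 2/5; the common weight 3/8 is split evenly over two coordinates.\<close>

definition states :: "3 \<Rightarrow> complex^4^4" where
  "states = triple (blk (5/8) 0 0 (3/16)) (blk (9/40) (3/10) (2/5) (3/16))
     (blk (9/40) (-3/10) (2/5) (3/16))"

lemma density_matrix_states: "density_matrix (states i)"
proof -
  have "\<forall>i. density_matrix (states i)"
    unfolding forall_3 states_def density_matrix_def
    by (auto intro!: psd_blk simp: power2_eq_square)
  then show ?thesis ..
qed

text \<open>The listed tuples are the qubit blocks of the states; the inequalities say that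
  \<open>K\<close> minus each weighted state is positive, block by block.\<close>

lemma states_success_bounds:
  assumes dual: "\<forall>(i, a, b, c) \<in> {(1, 5/8, 0, 0), (2, 9/40, 3/10, 2/5), (3, 9/40, -3/10, 2/5)}.
      w $ i * a \<le> a' \<and> (b' - w $ i * b)\<^sup>2 \<le> (a' - w $ i * a) * (c' - w $ i * c) \<and>
      w $ i * c \<le> c' \<and> w $ i * (3/16) \<le> d'"
    and M: "povm M"
  shows "(\<Sum>i\<in>UNIV. w $ i * Re (trace (states i ** M i))) \<le> success states w"
    and "success states w \<le> a' + c' + 2 * d'"
proof -
  have dom: "w $ i * Re (trace (states i ** N)) \<le> Re (trace (blk a' b' c' d' ** N))"
    if "psd N" for i N
  proof -
    have "\<forall>i. w $ i * Re (trace (states i ** N)) \<le> Re (trace (blk a' b' c' d' ** N))"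
      unfolding forall_3 states_def triple_simps
      by (intro conjI trace_blk_mult_mono[OF that]) (use dual in auto)
    then show ?thesis ..
  qed
  show "(\<Sum>i\<in>UNIV. w $ i * Re (trace (states i ** M i))) \<le> success states w"
    using dom M by (rule score_le_success)
  show "success states w \<le> a' + c' + 2 * d'"
    using success_le_trace[OF dom M] by simp
qed

lemma povm_triple_blk:
  assumes "psd (blk a b c d)" "psd (blk a' b' c' d')" "psd (blk a'' b'' c'' d'')"
    and "a + a' + a'' = 1" "b + b' + b'' = 0" "c + c' + c'' = 1" "d + d' + d'' = 1"
  shows "povm (triple (blk a b c d) (blk a' b' c' d') (blk a'' b'' c'' d''))"
  using assms by (auto simp: povm_def triple_def sum_3 blk_add blk_one)

text \<open>The pair measurements are the Helstrom projectors onto the positive and negative parts of the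
  difference of the two qubit states; in \<open>povm123\<close> the qubit blocks are multiples of the pure states,
  scaled to sum to the identity.  The common block may be assigned to any single outcome.\<close>

definition povm12 where
  "povm12 = triple (blk (9/10) (-3/10) (1/10) 1) (blk (1/10) (3/10) (9/10) 0) (blk 0 0 0 0)"

definition povm13 where
  "povm13 = triple (blk (9/10) (3/10) (1/10) 1) (blk 0 0 0 0) (blk (1/10) (-3/10) (9/10) 0)"

definition povm23 where
  "povm23 = triple (blk 0 0 0 0) (blk (1/2) (1/2) (1/2) 1) (blk (1/2) (-1/2) (1/2) 0)"

definition povm123 where
  "povm123 = triple (blk (7/16) 0 0 1) (blk (9/32) (3/8) (1/2) 0) (blk (9/32) (-3/8) (1/2) 0)"

lemma povms: "povm povm12" "povm povm13" "povm povm23" "povm povm123"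
  unfolding povm12_def povm13_def povm23_def povm123_def
  by (intro povm_triple_blk psd_blk; simp add: power2_eq_square)+

lemma score_povms:
  "(\<Sum>i\<in>UNIV. w $ i * Re (trace (states i ** povm12 i))) = w$1 * (15/16) + w$2 * (9/16)"
  "(\<Sum>i\<in>UNIV. w $ i * Re (trace (states i ** povm13 i))) = w$1 * (15/16) + w$3 * (9/16)"
  "(\<Sum>i\<in>UNIV. w $ i * Re (trace (states i ** povm23 i))) = w$2 * (79/80) + w$3 * (49/80)"
  "(\<Sum>i\<in>UNIV. w $ i * Re (trace (states i ** povm123 i))) =
     w$1 * (83/128) + (w$2 + w$3) * (125/256)"
  by (simp_all add: sum_3 states_def povm12_def povm13_def povm23_def povm123_def trace_blk_mult,
      simp_all add: blk_def)

section \<open>The profile\<close>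

lemma indicator_weights [simp]: "(\<chi> i. (indicator H i :: real)) $ i = (if i \<in> H then 1 else 0)"
  by (simp add: indicator_def)

text \<open>The dual witness for a pair i, j is the state j plus the positive part of the difference of the
  states i and j; for the triple it is 5/8 times the identity on the qubit block.\<close>

lemma success_states_indicator:
  "success states (\<chi> i. indicator {1, 2} i) = 3/2"
  "success states (\<chi> i. indicator {1, 3} i) = 3/2"
  "success states (\<chi> i. indicator {2, 3} i) = 8/5"
  "success states (\<chi> i. indicator {1, 2, 3} i) = 13/8"
proof -
  show "success states (\<chi> i. indicator {1, 2} i) = 3/2"
    using states_success_bounds[OF _ povms(1), of "\<chi> i. indicator {1, 2} i"
        "27/40" "3/20" "9/20" "3/16"]
    unfolding score_povms by (auto simp: power2_eq_square)
  show "success states (\<chi> i. indicator {1, 3} i) = 3/2"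
    using states_success_bounds[OF _ povms(2), of "\<chi> i. indicator {1, 3} i"
        "27/40" "-3/20" "9/20" "3/16"]
    unfolding score_povms by (auto simp: power2_eq_square)
  show "success states (\<chi> i. indicator {2, 3} i) = 8/5"
    using states_success_bounds[OF _ povms(3), of "\<chi> i. indicator {2, 3} i"
        "21/40" 0 "7/10" "3/16"]
    unfolding score_povms by (auto simp: power2_eq_square)
  show "success states (\<chi> i. indicator {1, 2, 3} i) = 13/8"
    using states_success_bounds[OF _ povms(4), of "\<chi> i. indicator {1, 2, 3} i"
        "5/8" 0 "5/8" "3/16"]
    unfolding score_povms by (auto simp: power2_eq_square)
qed

lemma quantum_profile_states:
  "profile_vector (quantum_profile states) = vector [1/2, 1/2, 2/5, 11/8]"
  unfolding profile_vector_def quantum_profile_def err_def success_states_indicator sum_3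
  by simp

text \<open>By inclusion-exclusion for maxima, a classical pair error is the total of the pairwise
  minimum, and the classical defect is minus the total of the triple minimum. So the mass common to
  all three must be 1/2 + 1/2 + 2/5 - 11/8 = 1/40.\<close>

lemma states_profile_classical: "profile_vector (quantum_profile states) \<in> classical_region"
proof -
  \<comment> \<open>Each point is shared, with equal mass, by a set of states; the masses solve the profile equations:
    1/40 for all three, 19/40, 19/40, 3/8 for the pairs, and the remaining mass is private.\<close>
  define p :: "3 \<Rightarrow> nat \<Rightarrow> real" where
    "p = triple (\<lambda>x. [1/40, 19/40, 19/40, 0, 1/40, 0, 0] ! x)
       (\<lambda>x. [1/40, 19/40, 0, 3/8, 0, 1/8, 0] ! x) (\<lambda>x. [1/40, 0, 19/40, 3/8, 0, 0, 1/8] ! x)"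
  define X :: "nat set" where "X = {0, 1, 2, 3, 4, 5, 6}"
  have "\<forall>i. prob_distribution_on X (p i)"
    unfolding forall_3 by (simp add: prob_distribution_on_def X_def p_def)
  moreover have "profile_vector (classical_profile X p) = vector [1/2, 1/2, 2/5, 11/8]"
    by (simp add: profile_vector_def classical_profile_def X_def p_def)
  moreover have "finite X"
    by (simp add: X_def)
  ultimately show ?thesis
    unfolding quantum_profile_states classical_region_def mem_Collect_eq
    by (intro exI[of _ X] exI[of _ p]) simp
qed

lemma triple_defect_states: "0 < triple_defect states (vector [3/2, 1, 1])"
proof -
  define w :: "real^3" where "w = vector [3/2, 1, 1]"
  note w = w_def restrict_weights_def
  \<comment> \<open>Domination of state 1 needs 15/16 = (3/2)(5/8); the mirror symmetry of states 2
    and 3 suggests a zero off-diagonal. The last qubit entry must then be at least 10/19, which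
    17/32 slightly exceeds.\<close>
  have "success states w \<le> 65/32"
    using states_success_bounds[OF _ povms(1), of w
        "15/16" 0 "17/32" "9/32"]
    by (auto simp: w power2_eq_square)
  \<comment> \<open>The equal-weight projectors suffice as lower bounds for the pairs; the same dual
    witness gives boundedness, since it also dominates zero.\<close>
  moreover have "63/32 \<le> success states (restrict_weights w {1, 2})"
    using states_success_bounds[OF _ povms(1), of "restrict_weights w {1, 2}"
        "15/16" 0 "17/32" "9/32"]
    unfolding score_povms by (auto simp: w power2_eq_square)
  moreover have "63/32 \<le> success states (restrict_weights w {1, 3})"
    using states_success_bounds[OF _ povms(2), of "restrict_weights w {1, 3}"
        "15/16" 0 "17/32" "9/32"]
    unfolding score_povms by (auto simp: w power2_eq_square)
  moreover have "8/5 \<le> success states (restrict_weights w {2, 3})"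
    using states_success_bounds[OF _ povms(3), of "restrict_weights w {2, 3}"
        "15/16" 0 "17/32" "9/32"]
    unfolding score_povms by (auto simp: w power2_eq_square)
  moreover have "(\<Sum>i\<in>UNIV. w $ i) = 7/2" "(\<Sum>i\<in>UNIV. restrict_weights w {1, 2} $ i) = 5/2"
    "(\<Sum>i\<in>UNIV. restrict_weights w {1, 3} $ i) = 5/2"
    "(\<Sum>i\<in>UNIV. restrict_weights w {2, 3} $ i) = 2"
    by (simp_all add: sum_3 w)
  ultimately show ?thesis
    \<comment> \<open>The bounds leave a defect of at least 1/160.\<close>
    unfolding triple_defect_def err_def w_def[symmetric] by linarith
qed

theorem proposition8p1:
  shows "\<exists>\<rho> :: 3 \<Rightarrow> complex^4^4.
    (\<forall>i. density_matrix (\<rho> i)) \<and>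
    profile_vector (quantum_profile \<rho>) \<in> classical_region \<and>
    (\<exists>w :: real^3. (\<forall>i. 0 < w $ i) \<and> 0 < triple_defect \<rho> w)"
proof (intro exI conjI allI)
  show "0 < triple_defect states (vector [3/2, 1, 1])"
    by (fact triple_defect_states)
  show "0 < (vector [3/2, 1, 1] :: real^3) $ i" for i
  proof -
    have "\<forall>i. 0 < (vector [3/2, 1, 1] :: real^3) $ i"
      unfolding forall_3 by simp
    then show ?thesis ..
  qed
qed (fact density_matrix_states states_profile_classical)+

end
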